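(* Let $p$ be a prime and let $m,n$ be positive integers. The power graph $\mathcal{G}(\mathbb{Z}_{p^m}^n)$ is a flower graph if and only if $n\ge 2$ and $m=1$.
   Context: For a finite group $G$, the power graph $\mathcal{G}(G)$ is the simple graph with vertex set $G$ in which two distinct vertices are adjacent if and only if one is a power of the other. $\mathbb{Z}_{k}$ denotes the cyclic group of order $k$ and $\mathbb{Z}_k^n$ the direct product of $n$ copies of $\mathbb{Z}_k$. A block graph is a graph in which every block (maximal connected subgraph without a cut vertex) is a complete graph; a flower graph is a block graph with exactly one cut vertex. *)

theory Defs
  imports
    "HOL-Computational_Algebra.Primes"
    "HOL-Algebra.Elementary_Groups"
    "HOL-Algebra.Product_Groups"
    "Graph_Theory.Kuratowski"
begin

text \<open>
  Undirected simple graphs are symmetric digraphs without loops and parallel arcs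
  (locale \<^locale>\<open>graph\<close>), so an edge \<open>xy\<close> is the pair of arcs \<open>(x, y)\<close> and \<open>(y, x)\<close>.
\<close>

definition power_graph :: "('a, 'b) monoid_scheme \<Rightarrow> 'a pair_pre_digraph" where
  "power_graph G = \<lparr> pverts = carrier G,
     parcs = {(x, y). x \<in> carrier G \<and> y \<in> carrier G \<and> x \<noteq> y \<and>
       ((\<exists>k::nat. y = x [^]\<^bsub>G\<^esub> k) \<or> (\<exists>k::nat. x = y [^]\<^bsub>G\<^esub> k))} \<rparr>"

definition components :: "('a, 'b) pre_digraph \<Rightarrow> ('a, 'b) pre_digraph set" where
  "components G = {C. pre_digraph.max_subgraph G connected C}"

text \<open>
  Components are compared by \<^const>\<open>card\<close>, so this is meaningful for finite graphs only.
  In the graph with a single vertex, that vertex is not a cut vertex.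
\<close>

definition cut_vertex :: "('a, 'b) pre_digraph \<Rightarrow> 'a \<Rightarrow> bool" where
  "cut_vertex G v \<longleftrightarrow>
     v \<in> verts G \<and> card (components G) < card (components (pre_digraph.del_vert G v))"

text \<open>
  \<^const>\<open>subgraph\<close> also admits subdigraphs containing only one of the two arcs of an edge;
  requiring \<^const>\<open>graph\<close> excludes these. Cut vertices are those of the subgraph itself,
  not of the ambient graph.
\<close>

definition is_block :: "('a, 'b) pre_digraph \<Rightarrow> ('a, 'b) pre_digraph \<Rightarrow> bool" where
  "is_block G B \<longleftrightarrow>
     pre_digraph.max_subgraph G (\<lambda>H. graph H \<and> connected H \<and> (\<nexists>v. cut_vertex H v)) B"

definition block_graph :: "('a, 'b) pre_digraph \<Rightarrow> bool" where
  "block_graph G \<longleftrightarrow> graph G \<and> (\<forall>B. is_block G B \<longrightarrow> (\<exists>n. complete_digraph n B))"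

definition flower_graph :: "('a, 'b) pre_digraph \<Rightarrow> bool" where
  "flower_graph G \<longleftrightarrow> block_graph G \<and> (\<exists>!v. cut_vertex G v)"

end

theory Submission
  imports Defs "HOL-Number_Theory.Cong"
begin

text \<open>
  In a graph with a universal vertex \<open>e\<close>, two vertices \<open>c \<noteq> e\<close> and \<open>e\<close> adjacent to both \<open>a\<close> and
  \<open>b\<close> force \<open>a\<close> and \<open>b\<close> into a common block, so the graph is a flower iff adjacency off \<open>e\<close> is
  transitive (the graph is cliques glued at \<open>e\<close>) and the graph is not complete. The identity is
  universal in a power graph. For \<open>n = 1\<close> the subgroups form a chain and the power graph is complete.
  For \<open>m = 1\<close> every nonidentity element generates a group of order \<open>p\<close>, so adjacency off the
  identity means generating the same subgroup. For \<open>n, m \<ge> 2\<close> transitivity fails at the common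
  multiple \<open>p a = p b\<close> of \<open>a = (1, 0, \<dots>)\<close> and \<open>b = (1, p^(m-1), 0, \<dots>)\<close>.
\<close>

section \<open>Maximal subgraphs and components\<close>

lemma subgraph_antisym:
  assumes "subgraph G H" and "subgraph H G"
  shows "G = H"
  using assms by (intro pre_digraph.equality) (auto simp: subgraph_def compatible_def)

text \<open>By finiteness some extension of \<open>H\<close> satisfying \<open>P\<close> has the
  greatest number of vertices plus arcs; anything above it has the same vertex and arc sets.
  \<open>P\<close> is kept general because components and blocks are both maximal subgraphs.\<close>

lemma (in fin_digraph) max_subgraph_extension:
  assumes "subgraph H G" and "P H"
  obtains M where "subgraph H M" and "max_subgraph P M"
proof -
  let ?Q = "\<lambda>M. subgraph H M \<and> subgraph M G \<and> P M"
  let ?size = "\<lambda>M :: ('a, 'b) pre_digraph. card (verts M) + card (arcs M)"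
  have "subgraph H H"
    using assms(1) by (intro wf_digraph.subgraph_refl) auto
  then have "?Q H"
    using assms by auto
  moreover have "\<forall>M. ?Q M \<longrightarrow> ?size M < Suc (?size G)"
    by (auto simp: subgraph_def less_Suc_eq_le intro!: add_mono card_mono)
  ultimately obtain M where M: "?Q M" and greatest: "\<And>M'. ?Q M' \<Longrightarrow> ?size M' \<le> ?size M"
    using ex_has_greatest_nat[of ?Q H ?size "Suc (?size G)"] by blast
  have "M' = M" if sub: "subgraph M M'" "subgraph M' G" and "P M'" for M'
  proof -
    have fin: "finite (verts M')" "finite (arcs M')"
      using sub by (auto simp: subgraph_def intro: finite_subset)
    have ss: "verts M \<subseteq> verts M'" "arcs M \<subseteq> arcs M'"
      using sub by auto
    have "?size M' \<le> ?size M"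
      using greatest[of M'] M that subgraph_trans by blast
    moreover have "card (verts M) \<le> card (verts M')" "card (arcs M) \<le> card (arcs M')"
      using fin ss by (auto intro: card_mono)
    ultimately have "verts M = verts M'" "arcs M = arcs M'"
      using fin ss by (simp_all add: card_subset_eq)
    with sub show ?thesis
      by (intro subgraph_antisym) (auto simp: subgraph_def compatible_def)
  qed
  with M have "max_subgraph P M"
    by (intro max_subgraphI) auto
  with M that show ?thesis
    by blast
qed

lemma connected_if_universal_vertex:
  assumes "e \<in> verts G" and "\<And>v. v \<in> verts G \<Longrightarrow> v \<noteq> e \<Longrightarrow> e \<rightarrow>\<^bsub>G\<^esub> v"
  shows "connected G"
proof -
  have "(u, e) \<in> rtrancl_on (verts G) ((arcs_ends G)\<^sup>s)"
    and "(e, u) \<in> rtrancl_on (verts G) ((arcs_ends G)\<^sup>s)" if "u \<in> verts G" for u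
  proof -
    have "u = e \<or> (u, e) \<in> (arcs_ends G)\<^sup>s \<and> (e, u) \<in> (arcs_ends G)\<^sup>s"
      using assms(2)[OF that] by (force simp: symcl_def)
    then show "(u, e) \<in> rtrancl_on (verts G) ((arcs_ends G)\<^sup>s)"
      "(e, u) \<in> rtrancl_on (verts G) ((arcs_ends G)\<^sup>s)"
      using that assms(1) by (auto intro: rtrancl_on_into_rtrancl_on)
  qed
  with assms(1) show ?thesis
    unfolding connected_conv by (blast intro: rtrancl_on_trans)
qed

lemma (in wf_digraph) components_if_connected:
  assumes "connected G"
  shows "components G = {G}"
proof -
  have "max_subgraph connected G"
    using assms subgraph_refl by (auto intro!: max_subgraphI dest: subgraph_antisym)
  moreover have "C = G" if "max_subgraph connected C" for C
    using that assms subgraph_refl by (auto simp: max_subgraph_def)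
  ultimately show ?thesis
    by (auto simp: components_def)
qed

text \<open>A subgraph shares \<open>tail\<close> and \<open>head\<close> with \<open>G\<close>, so
  its vertex and arc sets determine it. Counting components with \<open>card\<close> is thus
  meaningful.\<close>

lemma (in fin_digraph) finite_components: "finite (components G)"
proof (rule finite_subset)
  let ?mk = "\<lambda>(V, A). \<lparr>verts = V, arcs = A, tail = tail G, head = head G\<rparr>"
  show "components G \<subseteq> ?mk ` (Pow (verts G) \<times> Pow (arcs G))"
  proof
    fix C assume "C \<in> components G"
    then have "subgraph C G"
      by (auto simp: components_def max_subgraph_def)
    then have "C = ?mk (verts C, arcs C)" "(verts C, arcs C) \<in> Pow (verts G) \<times> Pow (arcs G)"
      by (auto simp: subgraph_def compatible_def)
    then show "C \<in> ?mk ` (Pow (verts G) \<times> Pow (arcs G))"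
      by (rule image_eqI)
  qed
qed auto

text \<open>A single vertex induces a connected subgraph, which extends to a maximal one.\<close>

lemma (in fin_digraph) vertex_in_component:
  assumes "v \<in> verts G"
  obtains C where "C \<in> components G" and "v \<in> verts C"
proof -
  have sub: "subgraph (G \<restriction> {v}) G"
    using assms by (intro subgraph_induce_subgraphI) auto
  have con: "connected (G \<restriction> {v})"
    by (rule connected_if_universal_vertex[of v]) auto
  obtain M where "subgraph (G \<restriction> {v}) M" "max_subgraph connected M"
    by (rule max_subgraph_extension[OF sub, of connected, OF con])
  then show ?thesis
    by (intro that[of M]) (auto simp: components_def)
qed

text \<open>Every vertex lies in some component, so a sole component is a connected spanning
  subgraph.\<close>

lemma (in fin_digraph) connected_if_card_components_le_1:
  assumes "verts G \<noteq> {}" and "card (components G) \<le> 1"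
  shows "connected G"
proof -
  obtain v where "v \<in> verts G"
    using assms(1) by auto
  then obtain C where C: "C \<in> components G"
    by (rule vertex_in_component)
  have "v \<in> verts C" if "v \<in> verts G" for v
  proof -
    obtain D where D: "D \<in> components G" "v \<in> verts D"
      using \<open>v \<in> verts G\<close> by (rule vertex_in_component)
    have "D = C"
      using assms(2) finite_components C D(1) by (metis card_le_Suc0_iff_eq One_nat_def)
    with D show ?thesis
      by simp
  qed
  moreover have "subgraph C G" "connected C"
    using C by (auto simp: components_def max_subgraph_def)
  ultimately show ?thesis
    by (intro connected_spanning_imp_connected[of C]) (auto simp: spanning_def)
qed

text \<open>Replaces counting components by connectivity. The case \<open>verts G = {v}\<close> is
  excluded because the empty graph has no component, yet \<open>connected\<close> is false for
  it.\<close>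

lemma (in fin_digraph) cut_vertex_iff_del_vert_not_connected:
  assumes "connected G"
  shows "cut_vertex G v \<longleftrightarrow> v \<in> verts G \<and> verts G \<noteq> {v} \<and> \<not> connected (del_vert v)"
proof -
  interpret D: fin_digraph "del_vert v"
    by (rule fin_digraph_del_vert)
  have "1 < card (components (del_vert v)) \<longleftrightarrow> verts (del_vert v) \<noteq> {} \<and> \<not> connected (del_vert v)"
  proof
    assume less: "1 < card (components (del_vert v))"
    then obtain C where "C \<in> components (del_vert v)"
      by fastforce
    then have "verts C \<noteq> {}" "verts C \<subseteq> verts (del_vert v)"
      by (auto simp: components_def pre_digraph.max_subgraph_def connected_conv)
    with less show "verts (del_vert v) \<noteq> {} \<and> \<not> connected (del_vert v)"
      using D.components_if_connected by auto
  qed (use D.connected_if_card_components_le_1 in force)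
  moreover have "card (components G) = 1"
    using components_if_connected[OF assms] by simp
  ultimately show ?thesis
    by (auto simp: cut_vertex_def pre_digraph.verts_del_vert)
qed

lemma (in graph) graph_induce_subgraph:
  assumes "V \<subseteq> verts G"
  shows "graph (G \<restriction> V)"
proof -
  have ind: "induced_subgraph (G \<restriction> V) G"
    using assms by auto
  interpret V: digraph "G \<restriction> V"
    by (rule digraphI_induced[OF ind])
  show ?thesis
    by (rule V.graphI) (rule induced_graph_imp_symmetric[OF sym_arcs ind])
qed

lemma dominates_induce_subgraph_iff:
  "u \<rightarrow>\<^bsub>G \<restriction> V\<^esub> v \<longleftrightarrow> u \<rightarrow>\<^bsub>G\<^esub> v \<and> u \<in> V \<and> v \<in> V"
  by (auto simp: arcs_ends_conv)

lemma dominates_del_vert_iff: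
  "u \<rightarrow>\<^bsub>pre_digraph.del_vert G w\<^esub> v \<longleftrightarrow> u \<rightarrow>\<^bsub>G\<^esub> v \<and> u \<noteq> w \<and> v \<noteq> w"
  by (auto simp: arcs_ends_conv pre_digraph.del_vert_simps)

section \<open>Flower graphs with a universal vertex\<close>

text \<open>Whichever vertex is deleted, one of \<open>c\<close> and \<open>e\<close> survives and
  is still adjacent to all other vertices.\<close>

lemma (in fin_digraph) no_cut_vertex_if_two_universal_vertices:
  assumes "e \<in> verts G" and "\<And>v. v \<in> verts G \<Longrightarrow> v \<noteq> e \<Longrightarrow> e \<rightarrow> v"
    and "c \<in> verts G" and "\<And>v. v \<in> verts G \<Longrightarrow> v \<noteq> c \<Longrightarrow> c \<rightarrow> v" and "c \<noteq> e"
  shows "\<not> cut_vertex G v"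
proof -
  have "connected (del_vert v)"
  proof (cases "v = e")
    case True
    then show ?thesis
      using assms by (intro connected_if_universal_vertex[of c])
        (auto simp: pre_digraph.verts_del_vert dominates_del_vert_iff)
  next
    case False
    then show ?thesis
      using assms by (intro connected_if_universal_vertex[of e])
        (auto simp: pre_digraph.verts_del_vert dominates_del_vert_iff)
  qed
  then show ?thesis
    using connected_if_universal_vertex[OF assms(1,2)]
    by (auto simp: cut_vertex_iff_del_vert_not_connected)
qed

lemma complete_digraph_imp_connected:
  assumes "complete_digraph k G" and "verts G \<noteq> {}"
  shows "connected G"
proof -
  obtain e where "e \<in> verts G"
    using assms(2) by auto
  then show ?thesis
    using assms(1) by (intro connected_if_universal_vertex[of e]) (auto simp: complete_digraph_def)
qed

lemma complete_digraph_no_cut_vertex: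
  assumes "complete_digraph k G"
  shows "\<not> cut_vertex G v"
proof
  assume cut: "cut_vertex G v"
  interpret graph G
    using assms by (simp add: complete_digraph_def)
  have v: "v \<in> verts G"
    using cut by (simp add: cut_vertex_def)
  have "connected G"
    using complete_digraph_imp_connected[OF assms] v by auto
  then have ne: "verts G \<noteq> {v}" and ncon: "\<not> connected (del_vert v)"
    using cut by (auto simp: cut_vertex_iff_del_vert_not_connected)
  obtain e where "e \<in> verts G" "e \<noteq> v"
    using v ne by auto
  then have "connected (del_vert v)"
    using assms by (intro connected_if_universal_vertex[of e])
      (auto simp: complete_digraph_def pre_digraph.verts_del_vert dominates_del_vert_iff)
  with ncon show False ..
qed

lemma (in graph) block_complete_if_trans_off_vertex:
  assumes trans: "\<And>x y z. x \<rightarrow> y \<Longrightarrow> y \<rightarrow> z \<Longrightarrow> e \<notin> {x, y, z} \<Longrightarrow> x \<noteq> z \<Longrightarrow> x \<rightarrow> z"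
    and univ: "\<And>v. v \<in> verts G \<Longrightarrow> v \<noteq> e \<Longrightarrow> e \<rightarrow> v"
    and B: "is_block G B"
  shows "\<exists>k. complete_digraph k B"
proof -
  have sub: "subgraph B G" and "graph B" and con: "connected B" and ncut: "\<And>v. \<not> cut_vertex B v"
    using B by (auto simp: is_block_def max_subgraph_def)
  interpret B: graph B
    by fact
  have adj: "x \<rightarrow> y" if xy: "x \<in> verts B" "y \<in> verts B" "x \<noteq> y" for x y
  proof (cases "e \<in> {x, y}")
    case True
    then show ?thesis
      using xy sub univ graph_symmetric[of e] by (auto simp: subgraph_def)
  next
    case False
    \<comment> \<open>Since \<open>e\<close> is not a cut vertex of \<open>B\<close>, some walk from \<open>x\<close> to \<open>y\<close> avoids it.\<close>
    define H where "H = B.del_vert e"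
    have wfH: "wf_digraph H"
      unfolding H_def by (rule B.wf_digraph_del_vert)
    have "connected H"
    proof (cases "e \<in> verts B")
      case True
      then show ?thesis
        using ncut[of e] con xy by (auto simp: H_def B.cut_vertex_iff_del_vert_not_connected)
    next
      case False
      \<comment> \<open>No arc of \<open>B\<close> is incident to a vertex outside \<open>B\<close>,
        so the deletion changes nothing.\<close>
      then have "H = B"
        unfolding H_def
        by (intro pre_digraph.equality) (auto simp: pre_digraph.del_vert_simps)
      with con show ?thesis
        by simp
    qed
    moreover have "x \<in> verts H" "y \<in> verts H"
      using xy False by (auto simp: H_def pre_digraph.verts_del_vert)
    ultimately have "(x, y) \<in> rtrancl_on (verts H) ((arcs_ends H)\<^sup>s)"
      by (auto simp: connected_conv)
    then have "y = x \<or> x \<rightarrow> y"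
    \<comment> \<open>Along the walk, transitivity off \<open>e\<close> keeps every vertex equal or
      adjacent to \<open>x\<close>; equality covers walks that return to \<open>x\<close>.\<close>
    proof (induction rule: rtrancl_on_induct)
      case (step y z)
      have "e \<noteq> x" "e \<noteq> y" "e \<noteq> z"
        using step False by (auto simp: H_def pre_digraph.verts_del_vert)
      moreover have "y \<rightarrow> z"
        using step(2) adj_mono[OF _ sub] graph_symmetric
        by (auto simp: symcl_def H_def dominates_del_vert_iff)
      ultimately show ?case
        using step trans[of x y z] by auto
    qed simp
    with xy show ?thesis
      by auto
  qed
  have V: "verts B \<subseteq> verts G"
    using sub by auto
  \<comment> \<open>So far adjacency holds in \<open>G\<close>, while \<open>B\<close> might omit
    arcs. The induced subgraph contains \<open>B\<close> and is complete, hence connected without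
    cut vertices, so maximality of \<open>B\<close> makes the two equal.\<close>
  let ?K = "G \<restriction> verts B"
  interpret K: graph ?K
    using V by (rule graph_induce_subgraph)
  have K: "complete_digraph (card (verts B)) ?K"
    using adj V by (auto simp: complete_digraph_def dominates_induce_subgraph_iff K.graph_axioms
        dest: adj_not_same)
  have "connected ?K" "\<nexists>v. cut_vertex ?K v"
    using complete_digraph_imp_connected[OF K] complete_digraph_no_cut_vertex[OF K] con
    by (auto simp: connected_conv)
  moreover have "subgraph B ?K" "subgraph ?K G"
    using sub V by (auto intro: subgraph_induce_subgraphI2 subgraph_induce_subgraphI)
  ultimately have "?K = B"
    using B K.graph_axioms unfolding is_block_def max_subgraph_def by blast
  with K show ?thesis
    by auto
qed

lemma (in graph) trans_off_vertex_if_block_graph: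
  assumes "block_graph G" and e: "e \<in> verts G"
    and univ: "\<And>v. v \<in> verts G \<Longrightarrow> v \<noteq> e \<Longrightarrow> e \<rightarrow> v"
    and acb: "a \<rightarrow> c" "c \<rightarrow> b" "e \<notin> {a, c, b}" "a \<noteq> b"
  shows "a \<rightarrow> b"
proof -
  \<comment> \<open>Both \<open>e\<close> and \<open>c\<close> are universal in the subgraph induced by these four vertices, so it lies
    inside a block.\<close>
  let ?K = "G \<restriction> {a, b, c, e}"
  have V: "{a, b, c, e} \<subseteq> verts G"
    using acb e adj_in_verts by auto
  interpret K: graph ?K
    using V by (rule graph_induce_subgraph)
  have sub: "subgraph ?K G"
    using V by (rule subgraph_induce_subgraphI)
  have uc: "c \<rightarrow> a" "c \<rightarrow> b" "c \<rightarrow> e" and ue: "e \<rightarrow> a" "e \<rightarrow> b" "e \<rightarrow> c"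
    using acb univ V graph_symmetric by auto
  have "connected ?K"
    using ue by (intro connected_if_universal_vertex[of e]) (auto simp: dominates_induce_subgraph_iff)
  moreover have "\<not> cut_vertex ?K v" for v
    using uc ue acb(3)
    by (intro K.no_cut_vertex_if_two_universal_vertices[of e c])
      (auto simp: dominates_induce_subgraph_iff)
  ultimately have P: "graph ?K \<and> connected ?K \<and> (\<nexists>v. cut_vertex ?K v)"
    using K.graph_axioms by auto
  obtain M where "subgraph ?K M" "is_block G M"
    using max_subgraph_extension[OF sub, of "\<lambda>H. graph H \<and> connected H \<and> (\<nexists>v. cut_vertex H v)", OF P]
    unfolding is_block_def by blast
  moreover from this obtain k where "complete_digraph k M"
    using assms(1) by (auto simp: block_graph_def)
  ultimately have "a \<rightarrow>\<^bsub>M\<^esub> b" "subgraph M G"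
    using acb(4) by (auto simp: complete_digraph_def is_block_def max_subgraph_def subgraph_def)
  then show ?thesis
    by (rule adj_mono)
qed

text \<open>Transitivity off \<open>e\<close> amounts to completeness of all blocks. Given it,
  deleting \<open>e\<close> separates any two nonadjacent vertices, so incompleteness makes
  \<open>e\<close> a cut vertex. No other vertex can be one, as \<open>e\<close> keeps the rest
  connected.\<close>

theorem (in graph) flower_graph_iff_trans_off_universal_vertex:
  assumes e: "e \<in> verts G" and univ: "\<And>v. v \<in> verts G \<Longrightarrow> v \<noteq> e \<Longrightarrow> e \<rightarrow> v"
  shows "flower_graph G \<longleftrightarrow>
    (\<forall>x y z. x \<rightarrow> y \<longrightarrow> y \<rightarrow> z \<longrightarrow> e \<notin> {x, y, z} \<longrightarrow> x \<noteq> z \<longrightarrow> x \<rightarrow> z) \<and>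
    (\<exists>x\<in>verts G. \<exists>y\<in>verts G. x \<noteq> y \<and> \<not> x \<rightarrow> y)"
    (is "_ \<longleftrightarrow> ?trans \<and> ?incomplete")
proof
  assume flower: "flower_graph G"
  then have "block_graph G" and "\<exists>v. cut_vertex G v"
    by (auto simp: flower_graph_def)
  have ?trans
    using trans_off_vertex_if_block_graph[OF \<open>block_graph G\<close> e univ] by blast
  moreover have ?incomplete
  proof (rule ccontr)
    assume "\<not> ?incomplete"
    then have "complete_digraph (card (verts G)) G"
      by (auto simp: complete_digraph_def graph_axioms adj_in_verts dest: adj_not_same)
    then show False
      using \<open>\<exists>v. cut_vertex G v\<close> complete_digraph_no_cut_vertex[of _ G] by blast
  qed
  ultimately show "?trans \<and> ?incomplete" ..
next
  assume R: "?trans \<and> ?incomplete"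
  then obtain a b where ab: "a \<in> verts G" "b \<in> verts G" "a \<noteq> b" "\<not> a \<rightarrow> b"
    by blast
  have ne: "a \<noteq> e" "b \<noteq> e"
    using ab univ graph_symmetric by blast+
  have block: "block_graph G"
    unfolding block_graph_def
    using block_complete_if_trans_off_vertex[of e] R univ graph_axioms by blast
  have con: "connected G"
    using e univ by (rule connected_if_universal_vertex)
  have "\<not> connected (del_vert e)"
  proof
    assume "connected (del_vert e)"
    then have "(a, b) \<in> rtrancl_on (verts (del_vert e)) ((arcs_ends (del_vert e))\<^sup>s)"
      using ab ne by (auto simp: connected_conv pre_digraph.verts_del_vert)
    \<comment> \<open>A walk from \<open>a\<close> that avoids \<open>e\<close> collapses to a
      single arc, which contradicts the choice of \<open>a\<close> and \<open>b\<close>.\<close>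
    then have "b = a \<or> a \<rightarrow> b"
    proof (induction rule: rtrancl_on_induct)
      case (step y z)
      moreover have "y \<rightarrow> z"
        using step(2) graph_symmetric by (auto simp: symcl_def dominates_del_vert_iff)
      ultimately show ?case
        using R ne unfolding pre_digraph.verts_del_vert by blast
    qed simp
    with ab show False
      by auto
  qed
  then have "cut_vertex G e"
    using con e ab by (auto simp: cut_vertex_iff_del_vert_not_connected)
  moreover have "v = e" if "cut_vertex G v" for v
  proof (rule ccontr)
    assume "v \<noteq> e"
    then have "connected (del_vert v)"
      using e univ by (intro connected_if_universal_vertex[of e])
        (auto simp: pre_digraph.verts_del_vert dominates_del_vert_iff)
    with that con show False
      by (auto simp: cut_vertex_iff_del_vert_not_connected)
  qed
  ultimately show "flower_graph G"
    using block by (auto simp: flower_graph_def)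
qed

section \<open>Power graphs\<close>

lemma power_graph_simps [simp]:
  "pverts (power_graph G) = carrier G"
  "(x, y) \<in> parcs (power_graph G) \<longleftrightarrow> x \<in> carrier G \<and> y \<in> carrier G \<and> x \<noteq> y \<and>
     ((\<exists>k::nat. y = x [^]\<^bsub>G\<^esub> k) \<or> (\<exists>k::nat. x = y [^]\<^bsub>G\<^esub> k))"
  by (auto simp: power_graph_def)

lemma graph_power_graph:
  assumes "finite (carrier G)"
  shows "graph (with_proj (power_graph G))"
proof -
  have "parcs (power_graph G) \<subseteq> carrier G \<times> carrier G"
    by auto
  then have "finite (parcs (power_graph G))"
    using assms by (auto intro: finite_subset)
  then have "pair_graph (power_graph G)"
    using assms by unfold_locales (auto simp: symmetric_def sym_def)
  then show ?thesis
    by (rule pair_graph.pair_graphD_graph)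
qed

text \<open>The identity is the zeroth power of every element, hence a universal vertex to which the
  general criterion applies.\<close>

lemma (in group) flower_graph_power_graph_iff:
  assumes "finite (carrier G)"
  shows "flower_graph (power_graph G) \<longleftrightarrow>
    (\<forall>x y z. (x, y) \<in> parcs (power_graph G) \<longrightarrow> (y, z) \<in> parcs (power_graph G) \<longrightarrow>
      \<one> \<notin> {x, y, z} \<longrightarrow> x \<noteq> z \<longrightarrow> (x, z) \<in> parcs (power_graph G)) \<and>
    (\<exists>x\<in>carrier G. \<exists>y\<in>carrier G. x \<noteq> y \<and> (x, y) \<notin> parcs (power_graph G))"
proof -
  interpret P: graph "with_proj (power_graph G)"
    using assms by (rule graph_power_graph)
  have "(\<one>, v) \<in> parcs (power_graph G)" if "v \<in> carrier G" "v \<noteq> \<one>" for v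
  proof -
    have "\<one> = v [^] (0::nat)"
      by simp
    with that show ?thesis
      unfolding power_graph_simps by blast
  qed
  then show ?thesis
    using P.flower_graph_iff_trans_off_universal_vertex[of \<one>] by (simp del: power_graph_simps(2))
qed

section \<open>Groups of prime exponent\<close>

lemma (in group) root_of_power_if_prime_exponent:
  fixes p k :: nat
  assumes "prime p" and x: "x \<in> carrier G" and "x [^] p = \<one>" and "x [^] k \<noteq> \<one>"
  obtains j :: nat where "x = (x [^] k) [^] j"
proof -
  \<comment> \<open>Otherwise \<open>x [^] k\<close> would be the identity. So \<open>k\<close> is
    invertible modulo \<open>p\<close>, and its inverse is the exponent \<open>j\<close>.\<close>
  have "\<not> p dvd k"
    using assms by (auto simp: nat_pow_pow[symmetric])
  then have "coprime k p"
    using \<open>prime p\<close> by (metis coprime_commute prime_imp_coprime)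
  then obtain j where "[k * j = 1] (mod p)"
    by (auto dest: cong_solve_coprime_nat)
  then have "k * j mod p = 1"
    using prime_gt_1_nat[OF \<open>prime p\<close>] by (simp add: cong_def)
  then have "k * j = p * (k * j div p) + 1"
    by (metis mult_div_mod_eq)
  then have "x [^] (k * j) = (x [^] p) [^] (k * j div p) \<otimes> x [^] (1::nat)"
    using x by (metis nat_pow_mult nat_pow_pow)
  then have "x = (x [^] k) [^] j"
    using assms by (simp add: nat_pow_pow)
  with that show ?thesis .
qed

text \<open>If \<open>x\<close> is a power of \<open>y\<close>, inverting the exponent modulo
  \<open>p\<close> makes \<open>y\<close> a power of \<open>x\<close>. With all adjacencies oriented
  the same way, consecutive ones compose by multiplying exponents.\<close>

lemma (in group) power_graph_adj_iff_if_prime_exponent: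
  fixes p :: nat
  assumes "prime p" and exponent: "\<And>x. x \<in> carrier G \<Longrightarrow> x [^] p = \<one>"
    and "x \<noteq> \<one>" and "y \<noteq> \<one>"
  shows "(x, y) \<in> parcs (power_graph G) \<longleftrightarrow>
    x \<in> carrier G \<and> y \<in> carrier G \<and> x \<noteq> y \<and> (\<exists>k::nat. y = x [^] k)"
proof -
  have "\<exists>j::nat. y = x [^] j" if "x = y [^] k" "y \<in> carrier G" for k :: nat
    using root_of_power_if_prime_exponent[OF \<open>prime p\<close> that(2) exponent[OF that(2)], of k]
      that(1) \<open>x \<noteq> \<one>\<close> by blast
  then show ?thesis
    by auto
qed

lemma (in group) power_graph_trans_off_one_if_prime_exponent:
  fixes p :: nat
  assumes "prime p" and exponent: "\<And>x. x \<in> carrier G \<Longrightarrow> x [^] p = \<one>"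
    and "(x, y) \<in> parcs (power_graph G)" and "(y, z) \<in> parcs (power_graph G)"
    and ne: "\<one> \<notin> {x, y, z}" and "x \<noteq> z"
  shows "(x, z) \<in> parcs (power_graph G)"
proof -
  note adj_iff = power_graph_adj_iff_if_prime_exponent[OF \<open>prime p\<close> exponent]
  obtain k l :: nat where "y = x [^] k" "z = y [^] l"
    and car: "x \<in> carrier G" "z \<in> carrier G"
    using assms(3,4) ne adj_iff[of x y] adj_iff[of y z] by auto
  then have "z = x [^] (k * l)"
    by (simp add: nat_pow_pow)
  then show ?thesis
    using car ne \<open>x \<noteq> z\<close> by auto
qed

section \<open>Direct powers of cyclic groups of prime power order\<close>

lemma nat_pow_product_group_integer_mod_group:
  "x [^]\<^bsub>product_group I (\<lambda>_. integer_mod_group q)\<^esub> (k::nat) = (\<lambda>i\<in>I. (int k * x i) mod int q)"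
  by (induction k) (auto simp: nat_pow_def algebra_simps mod_simps intro!: restrict_ext)

text \<open>Divisors of \<open>p ^ m\<close> are powers of \<open>p\<close>, so the gcds of
  \<open>a\<close> and \<open>b\<close> with \<open>p ^ m\<close> are comparable under divisibility,
  and \<open>k * c = d\<close> is solvable when the gcd of \<open>c\<close> divides
  \<open>d\<close>. In additive notation, of two elements of a cyclic p-group one is a power of the
  other.\<close>

lemma multiple_cong_prime_power:
  fixes p a b m :: nat
  assumes "prime p"
  shows "\<exists>k. [k * a = b] (mod p ^ m) \<or> [k * b = a] (mod p ^ m)"
proof -
  obtain i j where i: "gcd a (p ^ m) = p ^ i" and j: "gcd b (p ^ m) = p ^ j"
    by (metis assms divides_primepow_nat gcd_dvd2)
  have solve: "\<exists>k. [k * c = d] (mod p ^ m)" if "gcd c (p ^ m) dvd d" for c d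
    using cong_solve_dvd_nat[OF that] by (auto simp: mult.commute)
  have "gcd a (p ^ m) dvd b \<or> gcd b (p ^ m) dvd a"
    unfolding i j by (metis i j gcd_dvd1 dvd_trans le_imp_power_dvd nat_le_linear)
  then show ?thesis
    using solve by blast
qed

theorem theorem3p1:
  fixes p m n :: nat
  assumes "prime p" and "m \<ge> 1" and "n \<ge> 1"
  shows "flower_graph (power_graph (product_group {..<n} (\<lambda>_. integer_mod_group (p ^ m))))
    \<longleftrightarrow> n \<ge> 2 \<and> m = 1"
proof -
  define q where "q = p ^ m"
  define G where "G = product_group {..<n} (\<lambda>_. integer_mod_group q)"
  let ?adj = "\<lambda>x y. (x, y) \<in> parcs (power_graph G)"
  have p: "p > 1"
    using \<open>prime p\<close> by (rule prime_gt_1_nat)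
  then have q: "q > 1"
    using \<open>m \<ge> 1\<close> by (simp add: q_def one_less_power del: One_nat_def)
  interpret group G
    by (simp add: G_def)
  have carrier: "carrier G = {..<n} \<rightarrow>\<^sub>E {0..<int q}"
    using q by (simp add: G_def carrier_integer_mod_group)
  have one: "\<one>\<^bsub>G\<^esub> = (\<lambda>i\<in>{..<n}. 0)"
    by (simp add: G_def)
  have pow: "x [^]\<^bsub>G\<^esub> k = (\<lambda>i\<in>{..<n}. (int k * x i) mod int q)" for x and k :: nat
    unfolding G_def by (rule nat_pow_product_group_integer_mod_group)
  have finite: "finite (carrier G)"
    by (auto simp: carrier intro: finite_PiE)
  note flower_iff = flower_graph_power_graph_iff[OF finite]
  have "flower_graph (power_graph G) \<longleftrightarrow> n \<ge> 2 \<and> m = 1"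
  proof (cases "n \<ge> 2")
    case False
    then have n: "{..<n} = {0}"
      using \<open>n \<ge> 1\<close> by auto
    have pow_if_cong: "\<exists>k::nat. y = x [^]\<^bsub>G\<^esub> k"
      if "x \<in> carrier G" "y \<in> carrier G" "[k * nat (x 0) = nat (y 0)] (mod q)" for x y k
    proof -
      have "[int k * x 0 = y 0] (mod int q)"
        using that by (auto simp: cong_int_iff[symmetric] carrier n PiE_iff)
      then have "(int k * x 0) mod int q = y 0"
        using that by (auto simp: cong_def carrier n PiE_iff)
      then have "y = x [^]\<^bsub>G\<^esub> k"
        using that(2) by (auto simp: pow carrier n PiE_iff extensional_def restrict_def)
      then show ?thesis ..
    qed
    \<comment> \<open>One of the two congruences between the sole coordinates is always solvable, so
      the graph is complete and the second condition of \<open>flower_iff\<close> fails.\<close>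
    have "?adj x y" if "x \<in> carrier G" "y \<in> carrier G" "x \<noteq> y" for x y
      using multiple_cong_prime_power[OF \<open>prime p\<close>, of "nat (x 0)" "nat (y 0)" m]
        pow_if_cong[of x y] pow_if_cong[of y x] that by (auto simp: q_def)
    then show ?thesis
      using False by (auto simp: flower_iff simp del: power_graph_simps(2))
  next
    case n: True
    \<comment> \<open>\<open>a\<close> and \<open>b t\<close> agree at coordinate 0 and can differ
      only at coordinate 1. The value \<open>t = 1\<close> gives the nonadjacent pair for
      \<open>m = 1\<close>, and \<open>t = p ^ (m - 1)\<close> the failure of transitivity for
      \<open>m >= 2\<close>.\<close>
    define a where "a = (\<lambda>i\<in>{..<n}. if i = 0 then 1 else 0 :: int)"
    define b where "b t = (\<lambda>i\<in>{..<n}. if i = 0 then 1 else if i = 1 then t else 0 :: int)" for t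
    have a: "a \<in> carrier G" and b: "\<And>t. t \<in> {0..<int q} \<Longrightarrow> b t \<in> carrier G"
      using q by (auto simp: a_def b_def carrier)
    have ab: "a \<noteq> b t" "\<not> ?adj a (b t)" if t: "0 < t" "t < int q" for t
    proof -
      have coords: "a 0 = 1" "a 1 = 0" "b t 0 = 1" "b t 1 = t"
        using n by (auto simp: a_def b_def)
      then show "a \<noteq> b t"
        using t by auto
      have "b t \<noteq> a [^]\<^bsub>G\<^esub> k" for k :: nat
      proof
        assume "b t = a [^]\<^bsub>G\<^esub> k"
        then have "b t 1 = (a [^]\<^bsub>G\<^esub> k) 1"
          by simp
        then show False
          using coords t n by (simp add: pow)
      qed
      moreover have "a \<noteq> b t [^]\<^bsub>G\<^esub> k" for k :: nat
      proof
        assume eq: "a = b t [^]\<^bsub>G\<^esub> k"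
        then have "a 0 = (b t [^]\<^bsub>G\<^esub> k) 0" "a 1 = (b t [^]\<^bsub>G\<^esub> k) 1"
          by simp_all
        \<comment> \<open>Coordinate 0 forces \<open>k\<close> to be 1 modulo \<open>q\<close>, and
          then coordinate 1 forces \<open>t\<close> to be 0 modulo \<open>q\<close>.\<close>
        then have "int k mod int q = 1" "(int k * t) mod int q = 0"
          using coords n by (simp_all add: pow)
        then have "t mod int q = 0"
          by (metis mod_mult_left_eq mult_1)
        with t show False
          by simp
      qed
      ultimately show "\<not> ?adj a (b t)"
        by auto
    qed
    show ?thesis
    proof (cases "m = 1")
      case True
      then have "x [^]\<^bsub>G\<^esub> p = \<one>\<^bsub>G\<^esub>" if "x \<in> carrier G" for x
        using that by (auto simp: pow one q_def)
      note trans = power_graph_trans_off_one_if_prime_exponent[OF \<open>prime p\<close> this]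
      have "b 1 \<in> carrier G" "a \<noteq> b 1" "\<not> ?adj a (b 1)"
        using b[of 1] ab[of 1] q by auto
      then have "flower_graph (power_graph G)"
        unfolding flower_iff using trans a by blast
      with n True show ?thesis
        by simp
    next
      case False
      then have m: "m \<ge> 2"
        using \<open>m \<ge> 1\<close> by simp
      \<comment> \<open>Chosen so that multiplication by \<open>p\<close> kills coordinate 1 of
        \<open>b t\<close>, which makes the \<open>p\<close>-th powers of \<open>a\<close> and
        \<open>b t\<close> coincide.\<close>
      define t where "t = int (p ^ (m - 1))"
      have tp: "int p * t = int q"
        using m by (simp add: t_def q_def power_eq_if)
      \<comment> \<open>Here \<open>m >= 2\<close> matters: coordinate 0 of \<open>?c\<close> is
        \<open>p\<close> itself, not reduced modulo \<open>q\<close>, so \<open>?c\<close> differs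
        from the identity, \<open>a\<close> and \<open>b t\<close>.\<close>
      have "int p ^ 1 < int p ^ m"
        using m p by (intro power_strict_increasing) auto
      then have pq: "int p < int q"
        by (simp add: q_def)
      have t: "0 < t" "t < int q"
        using p tp m by (auto simp: t_def q_def)
      let ?c = "a [^]\<^bsub>G\<^esub> p"
      have c0: "?c 0 = int p"
        using n pq by (simp add: pow a_def)
      have c: "?c = b t [^]\<^bsub>G\<^esub> p"
        unfolding pow using tp by (intro restrict_ext) (auto simp: a_def b_def)
      have "?c \<in> carrier G"
        using a by simp
      have coords: "a 0 = 1" "b t 0 = 1" "\<one>\<^bsub>G\<^esub> 0 = 0"
        using n by (auto simp: a_def b_def one)
      then have ne: "\<one>\<^bsub>G\<^esub> \<notin> {a, ?c, b t}" "a \<noteq> ?c" "?c \<noteq> b t"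
        using c0 p by (auto dest!: fun_cong[of _ _ 0])
      have "?adj a ?c"
        using a ne by auto
      moreover have "?adj ?c (b t)"
        using a b[of t] t ne c by auto
      ultimately have "\<not> flower_graph (power_graph G)"
        unfolding flower_iff using ne(1) ab[OF t] by blast
      with False show ?thesis
        by simp
    qed
  qed
  then show ?thesis
    by (simp add: G_def q_def)
qed

end
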